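(* For even $n=2k>4$, the group $M_n=\pi_1(\mathbb{C}^2-\mathcal{A}_n)$ is not abelian, where $\mathcal{A}_n$ is the complexified conic-line arrangement consisting of the circle through the vertices of a regular $n$-gon and the $n$ lines extending its edges.
   Context: Take a regular $n$-gon in $\mathbb{R}^2$ and draw a circle through its $n$ vertices. Extend the edges of the $n$-gon to infinite straight lines, and let $\mathcal{A}_n\subset\mathbb{C}^2$ be the resulting complexified arrangement, i.e. the union in $\mathbb{C}^2$ of the complexifications of the circle and of these $n$ lines. This is a real conic-line arrangement with one conic whose graph is a cycle of length $n$, and the conic passes through all the vertices of the graph. Here the graph of a real conic-line arrangement has as vertices the points of multiplicity larger than 2, and as edges the segments on the lines connecting such points when they lie on the same line. $M_n=\pi_1(\mathbb{C}^2-\mathcal{A}_n)$ denotes the fundamental group of the affine complement of $\mathcal{A}_n$. *)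

theory Defs
  imports "HOL-Analysis.Analysis" "HOL-Algebra.Group"
begin

section \<open>The fundamental group\<close>

definition loops_at :: "'a::real_normed_vector set \<Rightarrow> 'a \<Rightarrow> (real \<Rightarrow> 'a) set" where
  "loops_at S p = {g. path g \<and> path_image g \<subseteq> S \<and> pathstart g = p \<and> pathfinish g = p}"

definition loop_rel :: "'a::real_normed_vector set \<Rightarrow> 'a \<Rightarrow> ((real \<Rightarrow> 'a) \<times> (real \<Rightarrow> 'a)) set" where
  "loop_rel S p = {(g, h). g \<in> loops_at S p \<and> h \<in> loops_at S p \<and> homotopic_paths S g h}"

definition fundamental_group :: "'a::real_normed_vector set \<Rightarrow> 'a \<Rightarrow> (real \<Rightarrow> 'a) set monoid" where
  "fundamental_group S p =
     \<lparr>carrier = loops_at S p // loop_rel S p,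
      mult = (\<lambda>A B. \<Union>g\<in>A. \<Union>h\<in>B. loop_rel S p `` {g +++ h}),
      one = loop_rel S p `` {linepath p p}\<rparr>"

lemma equiv_loop_rel: "equiv (loops_at S p) (loop_rel S p)"
proof (rule equivI)
  show "refl_on (loops_at S p) (loop_rel S p)"
    by (auto simp: refl_on_def loop_rel_def loops_at_def)
  show "sym (loop_rel S p)"
    by (auto simp: sym_def loop_rel_def dest: homotopic_paths_sym)
  show "trans (loop_rel S p)"
    unfolding trans_def loop_rel_def by (blast dest: homotopic_paths_trans)
qed (auto simp: loop_rel_def)

lemma loops_at_join: "g \<in> loops_at S p \<Longrightarrow> h \<in> loops_at S p \<Longrightarrow> g +++ h \<in> loops_at S p"
  by (auto simp: loops_at_def path_image_join)

lemma loops_at_reverse: "g \<in> loops_at S p \<Longrightarrow> reversepath g \<in> loops_at S p"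
  by (auto simp: loops_at_def)

lemma loops_at_const: "p \<in> S \<Longrightarrow> linepath p p \<in> loops_at S p"
  by (auto simp: loops_at_def)

lemma loop_rel_join_congruent: "congruent2 (loop_rel S p) (loop_rel S p) (\<lambda>g h. loop_rel S p `` {g +++ h})"
proof (rule congruent2I')
  fix g g' h h'
  assume "(g, g') \<in> loop_rel S p" "(h, h') \<in> loop_rel S p"
  then have "(g +++ h, g' +++ h') \<in> loop_rel S p"
    by (auto simp: loop_rel_def loops_at_join)
       (auto simp: loops_at_def intro: homotopic_paths_join)
  then show "loop_rel S p `` {g +++ h} = loop_rel S p `` {g' +++ h'}"
    by (rule equiv_class_eq[OF equiv_loop_rel])
qed

lemma fundamental_group_mult:
  assumes "g \<in> loops_at S p" "h \<in> loops_at S p"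
  shows "(loop_rel S p `` {g}) \<otimes>\<^bsub>fundamental_group S p\<^esub> (loop_rel S p `` {h})
           = loop_rel S p `` {g +++ h}"
  using UN_equiv_class2[OF equiv_loop_rel equiv_loop_rel loop_rel_join_congruent assms]
  by (simp add: fundamental_group_def)

lemma group_fundamental_group:
  assumes "p \<in> S"
  shows "group (fundamental_group S p)"
proof (rule groupI)
  let ?G = "fundamental_group S p" and ?c = "\<lambda>g. loop_rel S p `` {g}"
  have car: "X \<in> carrier ?G \<longleftrightarrow> (\<exists>g\<in>loops_at S p. X = ?c g)" for X
    by (auto simp: fundamental_group_def quotient_def)
  have one: "\<one>\<^bsub>?G\<^esub> = ?c (linepath p p)" by (simp add: fundamental_group_def)
  have eqI: "?c g = ?c h"
    if "g \<in> loops_at S p" "h \<in> loops_at S p" "homotopic_paths S g h" for g h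
    using that by (intro equiv_class_eq[OF equiv_loop_rel]) (auto simp: loop_rel_def)
  note const = loops_at_const[OF assms]
  show "\<one>\<^bsub>?G\<^esub> \<in> carrier ?G" using car one const by blast
  fix X assume "X \<in> carrier ?G"
  then obtain g where g: "g \<in> loops_at S p" "X = ?c g" using car by blast
  have "?c (linepath p p +++ g) = ?c g"
    using g by (intro eqI loops_at_join const homotopic_paths_lid') (simp_all add: loops_at_def)
  then show "\<one>\<^bsub>?G\<^esub> \<otimes>\<^bsub>?G\<^esub> X = X"
    unfolding one g(2) fundamental_group_mult[OF const g(1)] .
  have "?c (reversepath g +++ g) = ?c (linepath p p)"
    using g(1) homotopic_paths_linv[of g S]
    by (intro eqI loops_at_join const loops_at_reverse) (simp_all add: loops_at_def)
  then have "?c (reversepath g) \<otimes>\<^bsub>?G\<^esub> X = \<one>\<^bsub>?G\<^esub>"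
    unfolding one g(2) fundamental_group_mult[OF loops_at_reverse[OF g(1)] g(1)] .
  then show "\<exists>Y\<in>carrier ?G. Y \<otimes>\<^bsub>?G\<^esub> X = \<one>\<^bsub>?G\<^esub>"
    using car loops_at_reverse[OF g(1)] by blast
  fix Y assume "Y \<in> carrier ?G"
  then obtain h where h: "h \<in> loops_at S p" "Y = ?c h" using car by blast
  show "X \<otimes>\<^bsub>?G\<^esub> Y \<in> carrier ?G"
    unfolding car g(2) h(2) fundamental_group_mult[OF g(1) h(1)]
    using loops_at_join[OF g(1) h(1)] by blast
  fix Z assume "Z \<in> carrier ?G"
  then obtain k where k: "k \<in> loops_at S p" "Z = ?c k" using car by blast
  have "homotopic_paths S (g +++ (h +++ k)) ((g +++ h) +++ k)"
    using g(1) h(1) k(1) by (intro homotopic_paths_assoc) (simp_all add: loops_at_def)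
  then have "?c ((g +++ h) +++ k) = ?c (g +++ (h +++ k))"
    by (intro eqI loops_at_join g(1) h(1) k(1)) (rule homotopic_paths_sym)
  then show "X \<otimes>\<^bsub>?G\<^esub> Y \<otimes>\<^bsub>?G\<^esub> Z = X \<otimes>\<^bsub>?G\<^esub> (Y \<otimes>\<^bsub>?G\<^esub> Z)"
    unfolding g(2) h(2) k(2)
    by (simp only: fundamental_group_mult g(1) h(1) k(1) loops_at_join)
qed


section \<open>The arrangement\<close>

text \<open>
  The defining equations have real coefficients but are written for an arbitrary real algebra
  \<open>'a\<close>: their zero sets are the real curves for \<open>'a = real\<close>, and the complexifications of
  these curves for \<open>'a = complex\<close>.
\<close>

definition circle_poly :: "real \<times> real \<Rightarrow> real \<Rightarrow> 'a::real_algebra_1 \<times> 'a \<Rightarrow> 'a" where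
  "circle_poly c r z =
     (fst z - of_real (fst c))\<^sup>2 + (snd z - of_real (snd c))\<^sup>2 - of_real (r\<^sup>2)"

definition line_poly :: "real \<times> real \<Rightarrow> real \<times> real \<Rightarrow> 'a::real_algebra_1 \<times> 'a \<Rightarrow> 'a" where
  "line_poly a b z =
     of_real (fst b - fst a) * (snd z - of_real (snd a))
     - of_real (snd b - snd a) * (fst z - of_real (fst a))"

lemma circle_poly_real:
  assumes "r \<ge> 0"
  shows "{z :: real \<times> real. circle_poly c r z = 0} = sphere c r"
proof -
  have "circle_poly c r z = 0 \<longleftrightarrow> (dist c z)\<^sup>2 = r\<^sup>2" for z :: "real \<times> real"
    by (cases c; cases z)
       (auto simp: circle_poly_def dist_Pair_Pair dist_real_def power2_commute)
  then show ?thesis using assms by (auto simp: power2_eq_iff_nonneg)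
qed

lemma line_poly_real:
  assumes "a \<noteq> b"
  shows "{z :: real \<times> real. line_poly a b z = 0} = affine hull {a, b}"
proof (intro Set.set_eqI iffI)
  fix z :: "real \<times> real"
  assume z: "z \<in> {z. line_poly a b z = 0}"
  define u where "u = (if fst a = fst b then (snd z - snd a) / (snd b - snd a)
                       else (fst z - fst a) / (fst b - fst a))"
  have eq: "(fst b - fst a) * (snd z - snd a) = (snd b - snd a) * (fst z - fst a)"
    using z by (simp add: line_poly_def)
  have "fst z = fst a + u * (fst b - fst a) \<and> snd z = snd a + u * (snd b - snd a)"
  proof (cases "fst a = fst b")
    case True
    then have "snd a \<noteq> snd b" using assms by (simp add: prod_eq_iff)
    then show ?thesis using True eq by (simp add: u_def)
  next
    case False
    then have "u * (snd b - snd a) = snd z - snd a" using eq by (simp add: u_def field_simps)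
    then show ?thesis using False by (simp add: u_def)
  qed
  then have "z = a + u *\<^sub>R (b - a)" by (simp add: prod_eq_iff)
  then show "z \<in> affine hull {a, b}" by (auto simp: affine_hull_2_alt)
next
  fix z :: "real \<times> real"
  assume "z \<in> affine hull {a, b}"
  then show "z \<in> {z. line_poly a b z = 0}"
    by (auto simp: affine_hull_2_alt line_poly_def algebra_simps)
qed

text \<open>
  The vertices of the regular \<open>n\<close>-gon with centre \<open>c\<close>, circumradius \<open>r\<close> and phase \<open>\<theta>\<close>, in cyclic
  order; since \<open>j\<close> and \<open>j + n\<close> give the same vertex, the edges join the vertices \<open>j\<close> and \<open>Suc j\<close>
  for \<open>j < n\<close>.
\<close>

definition ngon_vertex :: "nat \<Rightarrow> real \<times> real \<Rightarrow> real \<Rightarrow> real \<Rightarrow> nat \<Rightarrow> real \<times> real" where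
  "ngon_vertex n c r \<theta> j =
     c + r *\<^sub>R (cos (\<theta> + 2 * pi * real j / real n), sin (\<theta> + 2 * pi * real j / real n))"

lemma ngon_vertex_in_circle: "r \<ge> 0 \<Longrightarrow> ngon_vertex n c r \<theta> j \<in> sphere c r"
  by (simp add: ngon_vertex_def dist_norm norm_Pair power_mult_distrib flip: distrib_left)

lemma ngon_vertex_periodic: "n > 0 \<Longrightarrow> ngon_vertex n c r \<theta> (j + n) = ngon_vertex n c r \<theta> j"
proof -
  assume "n > 0"
  then have "\<theta> + 2 * pi * real (j + n) / real n = (\<theta> + 2 * pi * real j / real n) + 2 * pi"
    by (simp add: field_simps)
  then show ?thesis unfolding ngon_vertex_def by (simp only: sin_periodic cos_periodic)
qed

definition ngon_arrangement ::
    "nat \<Rightarrow> real \<times> real \<Rightarrow> real \<Rightarrow> real \<Rightarrow> (complex \<times> complex) set" where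
  "ngon_arrangement n c r \<theta> =
     {z. circle_poly c r z = 0}
     \<union> (\<Union>j<n. {z. line_poly (ngon_vertex n c r \<theta> j) (ngon_vertex n c r \<theta> (Suc j)) z = 0})"

end

theory Submission
  imports Defs "HOL-Complex_Analysis.Complex_Analysis"
begin

text \<open>
  For even \<open>n\<close> opposite edges are parallel, so a suitable affine function \<open>f\<close> equals \<open>0\<close> on one edge
  line and \<open>1\<close> on the opposite one, and maps the complement of the arrangement to the plane
  punctured at \<open>0\<close> and \<open>1\<close>. A complex line through \<open>p\<close> on which \<open>f\<close> is a coordinate meets the
  arrangement in finitely many points; it contains loops at \<open>p\<close> whose images wind once around one
  of the two punctures and not around the other, and such loops do not commute even in the
  twice punctured plane.
\<close>

section \<open>Non-commuting loops in the twice punctured plane\<close>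

text \<open>Evenly covered sets and their sheets can be cut down to \<open>S'\<close> and its
  preimage, keeping the same local inverses. This serves to remove the fibre over 1 from the
  squaring cover.\<close>

lemma covering_space_restrict:
  assumes cov: "covering_space C p S" and "S' \<subseteq> S"
  shows "covering_space (C \<inter> p -` S') p S'"
proof
  show "continuous_on (C \<inter> p -` S') p"
    using covering_space_imp_continuous[OF cov] continuous_on_subset by blast
  show "p ` (C \<inter> p -` S') = S'"
    using covering_space_imp_surjective[OF cov] \<open>S' \<subseteq> S\<close> by blast
  fix x assume "x \<in> S'"
  then have "x \<in> S" using \<open>S' \<subseteq> S\<close> by blast
  then obtain T v where T: "x \<in> T" "openin (top_of_set S) T"
    and v: "\<Union>v = C \<inter> p -` T" "\<And>u. u \<in> v \<Longrightarrow> openin (top_of_set C) u" "pairwise disjnt v"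
      "\<And>u. u \<in> v \<Longrightarrow> \<exists>q. homeomorphism u T p q"
    using cov unfolding covering_space_def by meson
  let ?v = "(\<lambda>u. u \<inter> p -` S') ` v"
  have "\<exists>q. homeomorphism (u \<inter> p -` S') (T \<inter> S') p q" if "u \<in> v" for u
  proof -
    obtain q where q: "homeomorphism u T p q" using v(4) \<open>u \<in> v\<close> by blast
    have "homeomorphism (u \<inter> p -` S') (T \<inter> S') p q"
      by (rule homeomorphism_of_subsets[OF q]) (use q in \<open>auto simp: homeomorphism_def\<close>)
    then show ?thesis by blast
  qed
  moreover have "openin (top_of_set (C \<inter> p -` S')) (u \<inter> p -` S')" if u: "u \<in> v" for u
  proof -
    obtain W where "open W" "u = C \<inter> W"
      using v(2)[OF u] by (meson openin_open)
    then show ?thesis by (auto simp: openin_open)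
  qed
  moreover have "openin (top_of_set S') (T \<inter> S')"
    using T(2) \<open>S' \<subseteq> S\<close> by (auto simp: openin_open)
  moreover have "\<Union>?v = (C \<inter> p -` S') \<inter> p -` (T \<inter> S')"
    using v(1) by blast
  moreover have "pairwise disjnt ?v"
    using v(3) unfolding pairwise_def disjnt_def by blast
  ultimately show "\<exists>T. x \<in> T \<and> openin (top_of_set S') T \<and>
      (\<exists>v. \<Union>v = C \<inter> p -` S' \<inter> p -` T \<and> (\<forall>u\<in>v. openin (top_of_set (C \<inter> p -` S')) u) \<and>
           pairwise disjnt v \<and> (\<forall>u\<in>v. \<exists>q. homeomorphism u T p q))"
    using T(1) \<open>x \<in> S'\<close> by (intro exI[of _ "T \<inter> S'"] conjI exI[of _ ?v]) auto
qed

text \<open>Any continuous logarithm of \<open>f - z\<close> computes the winding number, so a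
  product of two such functions, whose logarithms add, has the sum of their winding numbers.\<close>

lemma winding_number_log:
  assumes "path g" and f: "\<And>t. t \<in> {0..1} \<Longrightarrow> f t = z + exp (g t)"
  shows "winding_number f z = (pathfinish g - pathstart g) / (2 * of_real pi * \<i>)"
proof -
  have "winding_number f z = winding_number (\<lambda>t. f t - z) 0"
    by (rule winding_number_offset)
  also have "\<dots> = winding_number (exp \<circ> g) 0"
    by (rule winding_number_cong) (simp add: f)
  finally show ?thesis using winding_number_compose_exp[OF \<open>path g\<close>] by simp
qed

text \<open>
  On the double cover \<open>s \<mapsto> s\<^sup>2\<close> of the plane punctured at \<open>0\<close> and \<open>1\<close>, the lift \<open>A\<close> of \<open>a\<close> joins
  \<open>s\<close> to \<open>-s\<close>, so \<open>ab\<close> lifts to \<open>A(-B)\<close> and \<open>ba\<close> to \<open>BA\<close>, with \<open>B\<close> the closed lift of \<open>b\<close>. These have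
  different winding numbers around \<open>1\<close>: those of \<open>B\<close> and \<open>-B\<close> add up to that of \<open>b\<close>, which is odd.
\<close>

lemma not_homotopic_paths_commute:
  fixes a b :: "real \<Rightarrow> complex"
  assumes a: "path a" "path_image a \<subseteq> - {0, 1}" "pathstart a = w" "pathfinish a = w"
    and b: "path b" "path_image b \<subseteq> - {0, 1}" "pathstart b = w" "pathfinish b = w"
    and wa: "winding_number a 0 = 1"
    and wb: "winding_number b 0 = 0" "winding_number b 1 = 1"
  shows "\<not> homotopic_paths (- {0, 1}) (a +++ b) (b +++ a)"
proof
  assume hom: "homotopic_paths (- {0, 1}) (a +++ b) (b +++ a)"
  obtain q where q: "path q" "pathfinish q - pathstart q = 2 * of_real pi * \<i>"
      "\<And>t. t \<in> {0..1} \<Longrightarrow> a t = exp (q t)"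
    using winding_number_as_continuous_log[of a 0] a wa by auto
  obtain r where r: "path r" "pathfinish r = pathstart r"
      "\<And>t. t \<in> {0..1} \<Longrightarrow> b t = exp (r t)"
    using winding_number_as_continuous_log[of b 0] b wb by auto
  define A where "A = (\<lambda>t. exp (q t / 2))"
  \<comment> \<open>The shift \<open>q 0 - r 0\<close> makes \<open>B\<close> start where
    \<open>A\<close> does. Its exponential is 1, since \<open>q 0\<close> and \<open>r 0\<close> are
    both logarithms of \<open>w\<close>, so \<open>B\<close> is still a square root of
    \<open>b\<close>.\<close>
  define B where "B = (\<lambda>t. exp ((r t + (q 0 - r 0)) / 2))"
  have "exp (q 0) = exp (r 0)"
    using q(3)[of 0] r(3)[of 0] a(3) b(3) by (simp add: pathstart_def)
  then have Bsq: "(B t)\<^sup>2 = b t" if "t \<in> {0..1}" for t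
  proof -
    have "(B t)\<^sup>2 = exp (r t + (q 0 - r 0))"
      by (simp add: B_def power2_eq_square flip: exp_add)
    then show ?thesis using r(3)[OF that] \<open>exp (q 0) = exp (r 0)\<close> by (simp add: exp_add exp_diff)
  qed
  have Asq: "(A t)\<^sup>2 = a t" if "t \<in> {0..1}" for t
    using q(3)[OF that] by (simp add: A_def flip: exp_double)
  have pA: "path A" and pB: "path B"
    using q(1) r(1) unfolding A_def B_def path_def by (intro continuous_intros; simp)+
  have nB: "path (\<lambda>t. - B t)"
    using pB unfolding path_def by (intro continuous_intros)
  have B_ends: "pathstart B = pathstart A" "pathfinish B = pathstart A"
    using r(2) by (simp_all add: A_def B_def pathstart_def pathfinish_def)
  \<comment> \<open>Halving the increment \<open>2 * pi * \<i>\<close> of the logarithm leaves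
    \<open>pi * \<i>\<close>, which flips the sign of the square root.\<close>
  have "q 1 / 2 = q 0 / 2 + of_real pi * \<i>"
    using q(2) by (simp add: pathstart_def pathfinish_def field_simps)
  then have "exp (q 1 / 2) = - exp (q 0 / 2)"
    by (simp only: exp_add exp_pi_i mult_minus1_right)
  then have A_end: "pathfinish A = - pathstart A"
    by (simp add: A_def pathstart_def pathfinish_def)
  have A_ne: "A t \<noteq> 0 \<and> A t \<noteq> 1 \<and> A t \<noteq> -1" if "t \<in> {0..1}" for t
  proof -
    have "a t \<in> - {0, 1}" using a(2) that unfolding path_image_def by blast
    then show ?thesis using Asq[OF that] by auto
  qed
  have B_ne: "B t \<noteq> 0 \<and> B t \<noteq> 1 \<and> B t \<noteq> -1" if "t \<in> {0..1}" for t
  proof -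
    have "b t \<in> - {0, 1}" using b(2) that unfolding path_image_def by blast
    then show ?thesis using Bsq[OF that] by auto
  qed
  have imA: "path_image A \<subseteq> - {0, 1, - 1}"
    using A_ne by (simp add: path_image_def image_subset_iff)
  have imB: "path_image B \<subseteq> - {0, 1, - 1}"
    using B_ne by (simp add: path_image_def image_subset_iff)
  have imnB: "path_image (\<lambda>t. - B t) \<subseteq> - {0, 1, - 1}"
    using B_ne by (simp add: path_image_def image_subset_iff minus_equation_iff[of "B _"] eq_commute[of _ "B _"])
  have "covering_space (- {0} \<inter> (\<lambda>s. s\<^sup>2) -` (- {0, 1})) (\<lambda>s::complex. s\<^sup>2) (- {0, 1})"
    by (rule covering_space_restrict[OF covering_space_square_punctured_plane]) auto
  moreover have "- {0} \<inter> (\<lambda>s::complex. s\<^sup>2) -` (- {0, 1}) = - {0, 1, - 1}"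
    by (auto simp: power2_eq_1_iff)
  ultimately have cov: "covering_space (- {0, 1, - 1}) (\<lambda>s::complex. s\<^sup>2) (- {0, 1})"
    by simp
  have join: "pathfinish A = pathstart (\<lambda>t. - B t)"
    using A_end B_ends by (simp add: pathstart_def)
  have "homotopic_paths (- {0, 1, - 1}) (A +++ (\<lambda>t. - B t)) (B +++ A)"
  proof (rule covering_space_lift_homotopic_paths[OF cov _ _ _ _ hom])
    show "((A +++ (\<lambda>t. - B t)) t)\<^sup>2 = (a +++ b) t" if "t \<in> {0..1}" for t
      using that by (auto simp: joinpaths_def Asq Bsq)
    show "((B +++ A) t)\<^sup>2 = (b +++ a) t" if "t \<in> {0..1}" for t
      using that by (auto simp: joinpaths_def Asq Bsq)
  qed (use a b pA pB nB B_ends join imA imB imnB in \<open>auto simp: path_image_join\<close>)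
  then have "homotopic_paths (- {1}) (A +++ (\<lambda>t. - B t)) (B +++ A)"
    by (rule homotopic_paths_subset) auto
  then have "winding_number (A +++ (\<lambda>t. - B t)) 1 = winding_number (B +++ A) 1"
    by (rule winding_number_homotopic_paths)
  moreover have notin: "1 \<notin> path_image A" "1 \<notin> path_image B" "- 1 \<notin> path_image B"
      "1 \<notin> path_image (\<lambda>t. - B t)"
    using imA imB imnB by blast+
  \<comment> \<open>The contribution of \<open>A\<close> occurs on both sides and cancels.\<close>
  ultimately have eq: "winding_number (\<lambda>t. - B t) 1 = winding_number B 1"
    using pA pB nB B_ends join by (simp add: winding_number_join)
  obtain g where g: "path g" "\<And>t. t \<in> {0..1} \<Longrightarrow> B t = 1 + exp (g t)"
    using winding_number_as_continuous_log[OF pB notin(2)] by metis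
  obtain h where h: "path h" "\<And>t. t \<in> {0..1} \<Longrightarrow> B t = - 1 + exp (h t)"
    using winding_number_as_continuous_log[OF pB notin(3)] by metis
  \<comment> \<open>Since \<open>- B - 1 = - (B + 1)\<close>, adding \<open>pi * \<i>\<close> to the
    logarithm \<open>h\<close> of \<open>B + 1\<close> gives one for \<open>- B - 1\<close>.\<close>
  have "winding_number (\<lambda>t. - B t) 1 =
      (pathfinish (\<lambda>t. h t + of_real pi * \<i>) - pathstart (\<lambda>t. h t + of_real pi * \<i>))
        / (2 * of_real pi * \<i>)"
    using h by (intro winding_number_log) (auto simp: exp_add path_def intro!: continuous_intros)
  \<comment> \<open>From \<open>b - 1 = (B - 1) * (B + 1)\<close>, the sum \<open>g + h\<close> is a
    logarithm of \<open>b - 1\<close>.\<close>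
  moreover have "winding_number b 1 =
      (pathfinish (\<lambda>t. g t + h t) - pathstart (\<lambda>t. g t + h t)) / (2 * of_real pi * \<i>)"
  proof (rule winding_number_log)
    show "path (\<lambda>t. g t + h t)"
      using g(1) h(1) unfolding path_def by (intro continuous_intros)
    fix t :: real assume t: "t \<in> {0..1}"
    have "exp (g t + h t) = (B t - 1) * (B t + 1)"
      using g(2)[OF t] h(2)[OF t] by (simp add: exp_add)
    then show "b t = 1 + exp (g t + h t)"
      using Bsq[OF t] by (simp add: algebra_simps power2_eq_square)
  qed
  ultimately have "winding_number b 1 = winding_number B 1 + winding_number (\<lambda>t. - B t) 1"
    using winding_number_log[OF g]
    by (simp add: pathstart_def pathfinish_def add_divide_distrib diff_divide_distrib)
  then have "winding_number B 1 + winding_number B 1 = 1" using eq wb(2) by simp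
  moreover have "winding_number B 1 \<in> \<int>"
    using pB notin(2) B_ends by (intro integer_winding_number) auto
  then obtain z where "winding_number B 1 = of_int z" by (elim Ints_cases)
  ultimately have "of_int (z + z) = (of_int 1 :: complex)" by simp
  then have "z + z = 1" by (simp only: of_int_eq_iff)
  then show False by presburger
qed

section \<open>Transfer to spaces that map to the twice punctured plane\<close>

text \<open>Go from \<open>w\<close> to a small circle about \<open>z\<close>, once around it, and
  back the same way: the two tails cancel in every winding number.\<close>

lemma loop_around_one_puncture:
  fixes z w :: complex
  assumes "finite F" "z \<in> F" "w \<notin> F"
  obtains g where "path g" "path_image g \<subseteq> - F" "pathstart g = w" "pathfinish g = w"
    "winding_number g z = 1" "\<And>u. u \<in> F \<Longrightarrow> u \<noteq> z \<Longrightarrow> winding_number g u = 0"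
proof -
  obtain d where d: "d > 0" "\<And>u. u \<in> F \<Longrightarrow> u \<noteq> z \<Longrightarrow> d \<le> dist z u"
    using finite_set_avoid[OF \<open>finite F\<close>, of z] by auto
  \<comment> \<open>Half the separation keeps all other points of \<open>F\<close> outside the
    closed disc.\<close>
  define \<rho> where "\<rho> = d / 2"
  have far: "\<rho> < dist z u" if "u \<in> F" "u \<noteq> z" for u
    using d(1) d(2)[OF that] by (simp add: \<rho>_def)
  have \<rho>: "\<rho> > 0" using d(1) by (simp add: \<rho>_def)
  let ?c = "circlepath z \<rho>"
  have c: "path_image ?c \<subseteq> - F"
    using \<rho> far by (force simp: path_image_circlepath_nonneg)
  have "path_connected (- F)"
    using \<open>finite F\<close> by (intro path_connected_complement_countable) (auto simp: uncountable_infinite countable_finite)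
  moreover have "z + of_real \<rho> \<in> - F"
    using c pathstart_in_path_image[of ?c] by auto
  ultimately obtain e where e: "path e" "path_image e \<subseteq> - F" "pathstart e = w"
      "pathfinish e = z + of_real \<rho>"
    using \<open>w \<notin> F\<close> unfolding path_connected_def by (metis ComplI)
  let ?g = "e +++ (?c +++ reversepath e)"
  have wn: "winding_number ?g u = winding_number ?c u" if "u \<in> F" for u
  proof -
    have u: "u \<notin> path_image e" "u \<notin> path_image ?c" using e c that by auto
    have "winding_number ?g u = winding_number e u + winding_number (?c +++ reversepath e) u"
      using e u by (intro winding_number_join) (auto simp: path_image_join)
    also have "winding_number (?c +++ reversepath e) u
        = winding_number ?c u + winding_number (reversepath e) u"
      using e u by (intro winding_number_join) auto
    also have "winding_number (reversepath e) u = - winding_number e u"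
      using e u by (intro winding_number_reversepath) auto
    finally show ?thesis by simp
  qed
  show ?thesis
  proof (rule that)
    show "winding_number ?g z = 1"
      using wn[OF \<open>z \<in> F\<close>] winding_number_circlepath_centre[OF \<rho>] by simp
    show "winding_number ?g u = 0" if "u \<in> F" "u \<noteq> z" for u
      unfolding wn[OF that(1)]
      by (rule winding_number_zero_outside[of _ "cball z \<rho>"])
         (use \<rho> far[OF that] in \<open>auto simp: path_image_circlepath_nonneg\<close>)
  qed (use e c in \<open>auto simp: path_image_join\<close>)
qed

lemma fundamental_group_commD:
  assumes "comm_group (fundamental_group S p)" "g \<in> loops_at S p" "h \<in> loops_at S p"
  shows "homotopic_paths S (g +++ h) (h +++ g)"
proof -
  interpret comm_group "fundamental_group S p" by fact
  have "loop_rel S p `` {k} \<in> carrier (fundamental_group S p)" if "k \<in> loops_at S p" for k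
    using that by (auto simp: fundamental_group_def intro: quotientI)
  then have "loop_rel S p `` {g +++ h} = loop_rel S p `` {h +++ g}"
    using m_comm[of "loop_rel S p `` {g}" "loop_rel S p `` {h}"] assms(2,3)
    by (simp add: fundamental_group_mult)
  then have "(g +++ h, h +++ g) \<in> loop_rel S p"
    using assms(2,3) by (subst (asm) eq_equiv_class_iff[OF equiv_loop_rel]) (auto intro: loops_at_join)
  then show ?thesis by (simp add: loop_rel_def)
qed

text \<open>The section \<open>\<phi>\<close> of \<open>f\<close> carries loops that avoid finitely
  many parameters into \<open>S\<close>. If their classes commuted, composing the homotopy with
  \<open>f\<close> would give back the original loops, commuting in the plane without 0 and
  1.\<close>

lemma not_comm_fundamental_group:
  fixes f :: "'a::real_normed_vector \<Rightarrow> complex"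
  assumes f: "continuous_on S f" "f ` S \<subseteq> - {0, 1}"
    and \<phi>: "continuous_on UNIV \<phi>" "\<And>z. f (\<phi> z) = z"
    and fin: "finite {z. \<phi> z \<notin> S}" and p: "p = \<phi> w" "p \<in> S"
  shows "\<not> comm_group (fundamental_group S p)"
proof
  assume comm: "comm_group (fundamental_group S p)"
  define F where "F = {z. \<phi> z \<notin> S}"
  have F: "finite F" "w \<notin> F" "\<phi> ` (- F) \<subseteq> S"
    using fin p by (auto simp: F_def)
  \<comment> \<open>As \<open>f\<close> omits 0 and 1 on \<open>S\<close>, its section must leave
    \<open>S\<close> at these two parameters.\<close>
  have "0 \<in> F" "1 \<in> F" using f(2) \<phi>(2) by (force simp: F_def)+
  obtain a where a: "path a" "path_image a \<subseteq> - F" "pathstart a = w" "pathfinish a = w"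
      "winding_number a 0 = 1"
    using loop_around_one_puncture[OF F(1) \<open>0 \<in> F\<close> F(2)] by metis
  obtain b where b: "path b" "path_image b \<subseteq> - F" "pathstart b = w" "pathfinish b = w"
      "winding_number b 1 = 1" "winding_number b 0 = 0"
    using loop_around_one_puncture[OF F(1) \<open>1 \<in> F\<close> F(2)] \<open>0 \<in> F\<close> by (metis zero_neq_one)
  have loop: "\<phi> \<circ> g \<in> loops_at S p"
    if "path g" "path_image g \<subseteq> - F" "pathstart g = w" "pathfinish g = w" for g
    using that F(3) p \<phi>(1)
    by (auto simp: loops_at_def path_image_compose pathstart_compose pathfinish_compose
             intro!: path_continuous_image intro: continuous_on_subset)
  have "homotopic_paths S ((\<phi> \<circ> a) +++ (\<phi> \<circ> b)) ((\<phi> \<circ> b) +++ (\<phi> \<circ> a))"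
    using a b by (intro fundamental_group_commD[OF comm] loop)
  then have "homotopic_paths (- {0, 1}) (f \<circ> ((\<phi> \<circ> a) +++ (\<phi> \<circ> b))) (f \<circ> ((\<phi> \<circ> b) +++ (\<phi> \<circ> a)))"
    using f by (intro homotopic_paths_continuous_image) auto
  moreover have "f \<circ> ((\<phi> \<circ> g) +++ (\<phi> \<circ> h)) = g +++ h" for g h
    by (auto simp: fun_eq_iff joinpaths_def \<phi>(2))
  ultimately have "homotopic_paths (- {0, 1}) (a +++ b) (b +++ a)" by simp
  moreover have "- F \<subseteq> - {0, 1}" using \<open>0 \<in> F\<close> \<open>1 \<in> F\<close> by auto
  ultimately show False
    using not_homotopic_paths_commute[of a w b] a b by blast
qed

section \<open>Intersection of the arrangement with a complex line\<close>

lemma finite_quadratic_roots: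
  fixes \<alpha> \<beta> \<gamma> :: complex
  assumes "\<alpha> + \<beta> * w + \<gamma> * w\<^sup>2 \<noteq> 0"
  shows "finite {z. \<alpha> + \<beta> * z + \<gamma> * z\<^sup>2 = 0}"
proof -
  have eq: "poly [:\<alpha>, \<beta>, \<gamma>:] z = \<alpha> + \<beta> * z + \<gamma> * z\<^sup>2" for z
    by (simp add: algebra_simps power2_eq_square)
  with assms have "[:\<alpha>, \<beta>, \<gamma>:] \<noteq> 0" by (metis poly_0)
  then show ?thesis using poly_roots_finite[of "[:\<alpha>, \<beta>, \<gamma>:]"] unfolding eq by blast
qed

text \<open>Each defining equation becomes a polynomial of degree at most 2 in \<open>z\<close>, and
  its value at \<open>w\<close> shows that it is not the zero polynomial.\<close>

lemma finite_arrangement_on_line: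
  fixes u v :: "complex \<times> complex"
  defines "\<phi> \<equiv> \<lambda>z. (fst u + z * fst v, snd u + z * snd v)"
  assumes "\<phi> w \<notin> ngon_arrangement n c r \<theta>"
  shows "finite {z. \<phi> z \<in> ngon_arrangement n c r \<theta>}"
proof -
  let ?l = "\<lambda>j. line_poly (ngon_vertex n c r \<theta> j) (ngon_vertex n c r \<theta> (Suc j)) :: complex \<times> complex \<Rightarrow> complex"
  have circ: "finite {z. circle_poly c r (\<phi> z) = 0}"
  proof -
    let ?x = "fst u - of_real (fst c)" and ?y = "snd u - of_real (snd c)"
    have eq: "circle_poly c r (\<phi> z) = (?x\<^sup>2 + ?y\<^sup>2 - of_real (r\<^sup>2))
        + (2 * ?x * fst v + 2 * ?y * snd v) * z + ((fst v)\<^sup>2 + (snd v)\<^sup>2) * z\<^sup>2" for z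
      by (simp add: circle_poly_def \<phi>_def algebra_simps power2_eq_square)
    have "circle_poly c r (\<phi> w) \<noteq> 0" using assms by (simp add: ngon_arrangement_def)
    then show ?thesis unfolding eq by (rule finite_quadratic_roots)
  qed
  have line: "finite {z. ?l j (\<phi> z) = 0}" if "j < n" for j
  proof -
    let ?a = "ngon_vertex n c r \<theta> j" and ?b = "ngon_vertex n c r \<theta> (Suc j)"
    have eq: "?l j (\<phi> z) = ?l j u + (of_real (fst ?b - fst ?a) * snd v
        - of_real (snd ?b - snd ?a) * fst v) * z + 0 * z\<^sup>2" for z
      by (simp add: line_poly_def \<phi>_def algebra_simps)
    have "?l j (\<phi> w) \<noteq> 0" using assms that by (simp add: ngon_arrangement_def)
    then show ?thesis unfolding eq by (rule finite_quadratic_roots)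
  qed
  have "{z. \<phi> z \<in> ngon_arrangement n c r \<theta>}
      = {z. circle_poly c r (\<phi> z) = 0} \<union> (\<Union>j<n. {z. ?l j (\<phi> z) = 0})"
    by (auto simp: ngon_arrangement_def)
  then show ?thesis using circ line by simp
qed

section \<open>Opposite edges of the polygon\<close>

text \<open>Advancing by \<open>k\<close> steps adds \<open>pi\<close> to the angle, which is the
  point reflection in the centre.\<close>

lemma ngon_vertex_opposite:
  assumes "n = 2 * k" "k > 0"
  shows "ngon_vertex n c r \<theta> (j + k) = 2 *\<^sub>R c - ngon_vertex n c r \<theta> j"
proof -
  have "\<theta> + 2 * pi * real (j + k) / real n = (\<theta> + 2 * pi * real j / real n) + pi"
    using assms by (simp add: field_simps)
  then show ?thesis
    unfolding ngon_vertex_def by (simp only: sin_periodic_pi cos_periodic_pi) (simp add: scaleR_2)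
qed

text \<open>The value is twice the signed area of the triangle spanned by the edge and the centre,
  \<open>r\<^sup>2 * sin (2 * pi / n)\<close>, and \<open>2 * pi / n < pi\<close>.\<close>

lemma centre_not_on_edge_line:
  assumes "n > 2" "r > 0"
  shows "line_poly (ngon_vertex n c r \<theta> j) (ngon_vertex n c r \<theta> (Suc j)) c \<noteq> (0::real)"
proof -
  define t where "t = \<theta> + 2 * pi * real j / real n"
  define t' where "t' = \<theta> + 2 * pi * real (Suc j) / real n"
  have "t' - t = 2 * pi / real n"
    by (simp add: t_def t'_def field_simps flip: add_divide_distrib)
  moreover have "line_poly (ngon_vertex n c r \<theta> j) (ngon_vertex n c r \<theta> (Suc j)) c
      = r\<^sup>2 * sin (t' - t)"
    unfolding line_poly_def ngon_vertex_def sin_diff t_def[symmetric] t'_def[symmetric]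
    by (simp add: algebra_simps power2_eq_square)
  moreover have "sin (2 * pi / real n) > 0"
    using assms by (intro sin_gt_zero) (auto simp: field_simps)
  ultimately show ?thesis using \<open>r > 0\<close> by simp
qed

text \<open>The left side is \<open>line_poly a b\<close> at the reflected point
  \<open>2c - z\<close>, and an affine function takes at \<open>c\<close> the mean of its values at
  \<open>z\<close> and \<open>2c - z\<close>. So the opposite edge line is a level set of the same
  function.\<close>

lemma line_poly_opposite:
  fixes z :: "'a::real_field \<times> 'a"
  shows "line_poly (2 *\<^sub>R c - a) (2 *\<^sub>R c - b) z = of_real (2 * line_poly a b c) - line_poly a b z"
  by (simp add: line_poly_def algebra_simps)

theorem theorem4p5:
  fixes n k :: nat and c :: "real \<times> real" and r \<theta> :: real and p :: "complex \<times> complex"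
  assumes "n = 2 * k" and "n > 4"
    and "r > 0"
    and "p \<in> - ngon_arrangement n c r \<theta>"
  shows "\<not> comm_group (fundamental_group (- ngon_arrangement n c r \<theta>) p)"
proof -
  let ?a = "ngon_vertex n c r \<theta> 0" and ?b = "ngon_vertex n c r \<theta> (Suc 0)"
  \<comment> \<open>This is the value of \<open>l\<close> on the edge line opposite to
    \<open>l = 0\<close>.\<close>
  define d :: real where "d = 2 * line_poly ?a ?b c"
  define l :: "complex \<times> complex \<Rightarrow> complex" where "l = line_poly ?a ?b"
  define x y where "x = fst ?b - fst ?a" and "y = snd ?b - snd ?a"
  define m where "m = x\<^sup>2 + y\<^sup>2"
  \<comment> \<open>A normal vector of the edge, scaled so that the linear part of \<open>l\<close>
    takes the value \<open>d\<close> on it.\<close>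
  define v :: "complex \<times> complex" where "v = (of_real (- d * y / m), of_real (d * x / m))"
  have d: "d \<noteq> 0"
    using centre_not_on_edge_line[of n r c \<theta> 0] assms by (simp add: d_def)
  then have "x \<noteq> 0 \<or> y \<noteq> 0" by (auto simp: d_def line_poly_def x_def y_def)
  then have m: "m \<noteq> 0" by (simp add: m_def sum_power2_eq_zero_iff)
  \<comment> \<open>With these choices the line through \<open>p\<close> in direction
    \<open>v\<close> is parametrised by the value of \<open>l / d\<close>, and \<open>w\<close> is
    the parameter of \<open>p\<close>.\<close>
  define w where "w = l p / of_real d"
  define u where "u = (fst p - w * fst v, snd p - w * snd v)"
  define \<phi> where "\<phi> = (\<lambda>z. (fst u + z * fst v, snd u + z * snd v))"
  have \<phi>w: "\<phi> w = p" by (simp add: \<phi>_def u_def)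
  have lv: "of_real x * snd v - of_real y * fst v = of_real d"
  proof -
    have "x * (d * x / m) - y * (- d * y / m) = d * m / m"
      by (simp add: m_def power2_eq_square algebra_simps add_divide_distrib)
    also have "\<dots> = d" using m by simp
    finally have "of_real (x * (d * x / m) - y * (- d * y / m)) = (of_real d :: complex)"
      by (rule arg_cong)
    then show ?thesis by (simp add: v_def)
  qed
  have "l (\<phi> z) = l p + (z - w) * (of_real x * snd v - of_real y * fst v)" for z
    by (simp add: l_def line_poly_def \<phi>_def u_def x_def y_def algebra_simps)
  then have "l (\<phi> z) = z * of_real d" for z
    using d by (simp add: lv w_def left_diff_distrib)
  then have l\<phi>: "l (\<phi> z) / of_real d = z" for z
    using d by simp
  have l_ne: "l z \<noteq> 0" "l z \<noteq> of_real d" if "z \<in> - ngon_arrangement n c r \<theta>" for z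
  proof -
    have "line_poly (ngon_vertex n c r \<theta> j) (ngon_vertex n c r \<theta> (Suc j)) z \<noteq> 0" if "j < n" for j
      using that \<open>z \<in> _\<close> by (auto simp: ngon_arrangement_def)
    \<comment> \<open>The edges 0 and \<open>k\<close> are opposite: the first excludes the value 0,
      the second the value \<open>d\<close>.\<close>
    from this[of 0] this[of k] show "l z \<noteq> 0" "l z \<noteq> of_real d"
      using assms ngon_vertex_opposite[of n k c r \<theta> 0] ngon_vertex_opposite[of n k c r \<theta> "Suc 0"]
      by (simp_all add: l_def d_def line_poly_opposite)
  qed
  show ?thesis
  proof (rule not_comm_fundamental_group)
    show "continuous_on (- ngon_arrangement n c r \<theta>) (\<lambda>z. l z / of_real d)"
      using d unfolding l_def line_poly_def by (intro continuous_intros) auto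
    show "(\<lambda>z. l z / of_real d) ` (- ngon_arrangement n c r \<theta>) \<subseteq> - {0, 1}"
      using l_ne d by (auto simp: divide_eq_1_iff)
    show "continuous_on UNIV \<phi>"
      unfolding \<phi>_def by (intro continuous_intros)
    show "finite {z. \<phi> z \<notin> - ngon_arrangement n c r \<theta>}"
      using finite_arrangement_on_line[of u w v n c r \<theta>] \<phi>w assms(4) by (simp add: \<phi>_def)
    show "p = \<phi> w" using \<phi>w by simp
  qed (use l\<phi> assms(4) in auto)
qed

end
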